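(* Let $\mathbf{A}$ be an abelian category, and let $$0 \to A \xrightarrow{f} B \xrightarrow{g} C \to 0 \qquad\text{and}\qquad 0 \to A' \xrightarrow{f'} B' \xrightarrow{g'} C' \to 0$$ be short exact sequences in $\mathbf{A}$. Let $\alpha\colon A \to A'$, $\beta\colon B \to B'$ and $\gamma\colon C \to C'$ be morphisms of $\mathbf{A}$ such that $f'\alpha = \beta f$ and $g'\beta = \gamma g$. Then the following hold: (i) if $\alpha$ and $\gamma$ are monomorphisms, then $\beta$ is a monomorphism; (ii) if $\alpha$ and $\gamma$ are epimorphisms, then $\beta$ is an epimorphism; (iii) if $\alpha$ and $\gamma$ are isomorphisms, then $\beta$ is an isomorphism.
   Context: An additive category is a category in which every hom-set carries an abelian group structure such that composition distributes over addition on both sides, and which has a zero object and all binary products and coproducts. An abelian category is an additive category in which every morphism has a kernel and a cokernel, every monomorphism is a kernel of some morphism, and every epimorphism is a cokernel of some morphism. Here the kernel $\ker f\colon K_f \to A$ and the cokernel $\operatorname{cok} f\colon B \to C_f$ of a morphism $f\colon A \to B$ are morphisms, defined by the usual universal properties. A sequence $0 \to A \xrightarrow{f} B \xrightarrow{g} C \to 0$ in an abelian category (where $0$ is the zero object) is called exact, and is then called a short exact sequence, if $f$ is a monomorphism, $g$ is an epimorphism, $gf = 0$, and $(\operatorname{cok} f)(\ker g) = 0$. *)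

theory Defs
  imports "HOL-Algebra.Group"
begin

text \<open>
  Objects and morphisms are elements of the carriers \<open>Ob\<close> and \<open>Arr\<close>. Every morphism has
  one domain and one codomain, so distinct hom-sets are disjoint. \<open>Comp\<close> is written in
  the order of composition of functions and is only specified on composable pairs.
\<close>

record ('o, 'm) cat =
  Ob  :: "'o set"
  Arr :: "'m set"
  Dom :: "'m \<Rightarrow> 'o"
  Cod :: "'m \<Rightarrow> 'o"
  Id  :: "'o \<Rightarrow> 'm"
  Comp :: "['m, 'm] \<Rightarrow> 'm"  (infixr \<open>\<cdot>\<index>\<close> 70)

definition Hom :: "('o, 'm, 'x) cat_scheme \<Rightarrow> 'o \<Rightarrow> 'o \<Rightarrow> 'm set" where
  "Hom C A B = {f \<in> Arr C. Dom C f = A \<and> Cod C f = B}"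

locale category =
  fixes C :: "('o, 'm, 'x) cat_scheme" (structure)
  assumes Dom_closed: "f \<in> Arr C \<Longrightarrow> Dom C f \<in> Ob C"
    and Cod_closed: "f \<in> Arr C \<Longrightarrow> Cod C f \<in> Ob C"
    and Id_closed: "A \<in> Ob C \<Longrightarrow> Id C A \<in> Hom C A A"
    and Comp_closed: "\<lbrakk>f \<in> Hom C A B; g \<in> Hom C B D\<rbrakk> \<Longrightarrow> g \<cdot> f \<in> Hom C A D"
    and Comp_assoc: "\<lbrakk>f \<in> Hom C A B; g \<in> Hom C B D; h \<in> Hom C D E\<rbrakk>
      \<Longrightarrow> (h \<cdot> g) \<cdot> f = h \<cdot> (g \<cdot> f)"
    and Id_left: "f \<in> Hom C A B \<Longrightarrow> Id C B \<cdot> f = f"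
    and Id_right: "f \<in> Hom C A B \<Longrightarrow> f \<cdot> Id C A = f"

definition is_monomorphism :: "('o, 'm, 'x) cat_scheme \<Rightarrow> 'm \<Rightarrow> bool" where
  "is_monomorphism C f \<longleftrightarrow> f \<in> Arr C \<and>
     (\<forall>X \<in> Ob C. \<forall>u \<in> Hom C X (Dom C f). \<forall>v \<in> Hom C X (Dom C f).
        f \<cdot>\<^bsub>C\<^esub> u = f \<cdot>\<^bsub>C\<^esub> v \<longrightarrow> u = v)"

definition is_epimorphism :: "('o, 'm, 'x) cat_scheme \<Rightarrow> 'm \<Rightarrow> bool" where
  "is_epimorphism C f \<longleftrightarrow> f \<in> Arr C \<and>
     (\<forall>X \<in> Ob C. \<forall>u \<in> Hom C (Cod C f) X. \<forall>v \<in> Hom C (Cod C f) X.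
        u \<cdot>\<^bsub>C\<^esub> f = v \<cdot>\<^bsub>C\<^esub> f \<longrightarrow> u = v)"

definition is_isomorphism :: "('o, 'm, 'x) cat_scheme \<Rightarrow> 'm \<Rightarrow> bool" where
  "is_isomorphism C f \<longleftrightarrow> f \<in> Arr C \<and>
     (\<exists>g \<in> Hom C (Cod C f) (Dom C f).
        g \<cdot>\<^bsub>C\<^esub> f = Id C (Dom C f) \<and> f \<cdot>\<^bsub>C\<^esub> g = Id C (Cod C f))"

definition is_zero_object :: "('o, 'm, 'x) cat_scheme \<Rightarrow> 'o \<Rightarrow> bool" where
  "is_zero_object C Z \<longleftrightarrow> Z \<in> Ob C \<and>
     (\<forall>X \<in> Ob C. (\<exists>!f. f \<in> Hom C Z X) \<and> (\<exists>!f. f \<in> Hom C X Z))"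

definition is_product ::
    "('o, 'm, 'x) cat_scheme \<Rightarrow> 'o \<Rightarrow> 'o \<Rightarrow> 'o \<Rightarrow> 'm \<Rightarrow> 'm \<Rightarrow> bool" where
  "is_product C A B P p q \<longleftrightarrow> P \<in> Ob C \<and> p \<in> Hom C P A \<and> q \<in> Hom C P B \<and>
     (\<forall>X \<in> Ob C. \<forall>f \<in> Hom C X A. \<forall>g \<in> Hom C X B.
        \<exists>!h. h \<in> Hom C X P \<and> p \<cdot>\<^bsub>C\<^esub> h = f \<and> q \<cdot>\<^bsub>C\<^esub> h = g)"

definition is_coproduct ::
    "('o, 'm, 'x) cat_scheme \<Rightarrow> 'o \<Rightarrow> 'o \<Rightarrow> 'o \<Rightarrow> 'm \<Rightarrow> 'm \<Rightarrow> bool" where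
  "is_coproduct C A B S i j \<longleftrightarrow> S \<in> Ob C \<and> i \<in> Hom C A S \<and> j \<in> Hom C B S \<and>
     (\<forall>X \<in> Ob C. \<forall>f \<in> Hom C A X. \<forall>g \<in> Hom C B X.
        \<exists>!h. h \<in> Hom C S X \<and> h \<cdot>\<^bsub>C\<^esub> i = f \<and> h \<cdot>\<^bsub>C\<^esub> j = g)"

text \<open>
  Since hom-sets are disjoint, a single operation \<open>Add\<close> carries the additions of all of
  them. Its values are only specified on pairs of parallel morphisms.
\<close>

record ('o, 'm) add_cat = "('o, 'm) cat" +
  Add  :: "['m, 'm] \<Rightarrow> 'm"  (infixl \<open>\<boxplus>\<index>\<close> 65)
  Zero :: "'o \<Rightarrow> 'o \<Rightarrow> 'm"

definition Hom_group :: "('o, 'm, 'x) add_cat_scheme \<Rightarrow> 'o \<Rightarrow> 'o \<Rightarrow> 'm monoid" where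
  "Hom_group C A B = \<lparr>carrier = Hom C A B, mult = Add C, one = Zero C A B\<rparr>"

locale additive_category = category C for C :: "('o, 'm, 'x) add_cat_scheme" (structure) +
  assumes Hom_comm_group: "\<lbrakk>A \<in> Ob C; B \<in> Ob C\<rbrakk> \<Longrightarrow> comm_group (Hom_group C A B)"
    and Comp_Add_left: "\<lbrakk>f \<in> Hom C A B; g \<in> Hom C B D; h \<in> Hom C B D\<rbrakk>
      \<Longrightarrow> (g \<boxplus> h) \<cdot> f = (g \<cdot> f) \<boxplus> (h \<cdot> f)"
    and Comp_Add_right: "\<lbrakk>f \<in> Hom C A B; g \<in> Hom C A B; h \<in> Hom C B D\<rbrakk>
      \<Longrightarrow> h \<cdot> (f \<boxplus> g) = (h \<cdot> f) \<boxplus> (h \<cdot> g)"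
    and zero_object_exists: "\<exists>Z. is_zero_object C Z"
    and product_exists: "\<lbrakk>A \<in> Ob C; B \<in> Ob C\<rbrakk> \<Longrightarrow> \<exists>P p q. is_product C A B P p q"
    and coproduct_exists: "\<lbrakk>A \<in> Ob C; B \<in> Ob C\<rbrakk> \<Longrightarrow> \<exists>S i j. is_coproduct C A B S i j"

definition is_kernel :: "('o, 'm, 'x) add_cat_scheme \<Rightarrow> 'm \<Rightarrow> 'm \<Rightarrow> bool" where
  "is_kernel C f k \<longleftrightarrow> f \<in> Arr C \<and> k \<in> Arr C \<and> Cod C k = Dom C f \<and>
     f \<cdot>\<^bsub>C\<^esub> k = Zero C (Dom C k) (Cod C f) \<and>
     (\<forall>X \<in> Ob C. \<forall>h \<in> Hom C X (Dom C f). f \<cdot>\<^bsub>C\<^esub> h = Zero C X (Cod C f) \<longrightarrow>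
        (\<exists>!u. u \<in> Hom C X (Dom C k) \<and> k \<cdot>\<^bsub>C\<^esub> u = h))"

definition is_cokernel :: "('o, 'm, 'x) add_cat_scheme \<Rightarrow> 'm \<Rightarrow> 'm \<Rightarrow> bool" where
  "is_cokernel C f c \<longleftrightarrow> f \<in> Arr C \<and> c \<in> Arr C \<and> Dom C c = Cod C f \<and>
     c \<cdot>\<^bsub>C\<^esub> f = Zero C (Dom C f) (Cod C c) \<and>
     (\<forall>X \<in> Ob C. \<forall>h \<in> Hom C (Cod C f) X. h \<cdot>\<^bsub>C\<^esub> f = Zero C (Dom C f) X \<longrightarrow>
        (\<exists>!u. u \<in> Hom C (Cod C c) X \<and> u \<cdot>\<^bsub>C\<^esub> c = h))"

text \<open>
  Kernels and cokernels are unique only up to isomorphism; \<open>ker\<close> and \<open>cok\<close> choose one.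
  The vanishing of \<open>cok C f \<cdot>\<^bsub>C\<^esub> ker C g\<close> does not depend on these choices.
\<close>

definition ker :: "('o, 'm, 'x) add_cat_scheme \<Rightarrow> 'm \<Rightarrow> 'm" where
  "ker C f = (SOME k. is_kernel C f k)"

definition cok :: "('o, 'm, 'x) add_cat_scheme \<Rightarrow> 'm \<Rightarrow> 'm" where
  "cok C f = (SOME c. is_cokernel C f c)"

locale abelian_category = additive_category C
  for C :: "('o, 'm, 'x) add_cat_scheme" (structure) +
  assumes kernel_exists: "f \<in> Arr C \<Longrightarrow> \<exists>k. is_kernel C f k"
    and cokernel_exists: "f \<in> Arr C \<Longrightarrow> \<exists>c. is_cokernel C f c"
    and mono_is_kernel: "is_monomorphism C m \<Longrightarrow> \<exists>f. is_kernel C f m"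
    and epi_is_cokernel: "is_epimorphism C e \<Longrightarrow> \<exists>f. is_cokernel C f e"

definition short_exact ::
    "('o, 'm, 'x) add_cat_scheme \<Rightarrow> 'o \<Rightarrow> 'm \<Rightarrow> 'o \<Rightarrow> 'm \<Rightarrow> 'o \<Rightarrow> bool" where
  "short_exact \<A> A f B g C \<longleftrightarrow> f \<in> Hom \<A> A B \<and> g \<in> Hom \<A> B C \<and>
     is_monomorphism \<A> f \<and> is_epimorphism \<A> g \<and> g \<cdot>\<^bsub>\<A>\<^esub> f = Zero \<A> A C \<and>
     cok \<A> f \<cdot>\<^bsub>\<A>\<^esub> ker \<A> g = Zero \<A> (Dom \<A> (ker \<A> g)) (Cod \<A> (cok \<A> f))"

end

theory Submission
  imports Defs
begin

text \<open>
  In a short exact sequence \<open>f\<close> is a kernel of \<open>g\<close> and \<open>g\<close> is a cokernel of \<open>f\<close>. If \<open>\<beta> \<cdot> x = 0\<close>,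
  then \<open>\<gamma> \<cdot> g \<cdot> x = 0\<close>, hence \<open>g \<cdot> x = 0\<close> and \<open>x = f \<cdot> y\<close>; now \<open>f' \<cdot> \<alpha> \<cdot> y = \<beta> \<cdot> x = 0\<close> forces
  \<open>y = 0\<close>. This proves (i), and (ii) is dual. Finally (iii) follows because a morphism that is both
  a monomorphism and an epimorphism is an isomorphism in an abelian category.
\<close>

section \<open>Isomorphisms in an arbitrary category\<close>

context category
begin

lemma Hom_Ob:
  assumes "f \<in> Hom C A B"
  shows "A \<in> Ob C" "B \<in> Ob C"
  using assms Dom_closed Cod_closed by (auto simp: Hom_def)

lemma isomorphism_imp_monomorphism:
  assumes "is_isomorphism C f"
  shows "is_monomorphism C f"
proof -
  from assms obtain g where f: "f \<in> Hom C (Dom C f) (Cod C f)"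
    and g: "g \<in> Hom C (Cod C f) (Dom C f)" and gf: "g \<cdot> f = Id C (Dom C f)"
    unfolding is_isomorphism_def Hom_def by blast
  have "u = v" if "u \<in> Hom C X (Dom C f)" "v \<in> Hom C X (Dom C f)" "f \<cdot> u = f \<cdot> v" for X u v
  proof -
    have "u = (g \<cdot> f) \<cdot> u"
      using gf Id_left[OF that(1)] by simp
    also have "\<dots> = (g \<cdot> f) \<cdot> v"
      unfolding Comp_assoc[OF that(1) f g] Comp_assoc[OF that(2) f g] that(3) ..
    also have "\<dots> = v"
      using gf Id_left[OF that(2)] by simp
    finally show ?thesis .
  qed
  with f show ?thesis
    unfolding is_monomorphism_def Hom_def by blast
qed

lemma isomorphism_imp_epimorphism:
  assumes "is_isomorphism C f"
  shows "is_epimorphism C f"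
proof -
  from assms obtain g where f: "f \<in> Hom C (Dom C f) (Cod C f)"
    and g: "g \<in> Hom C (Cod C f) (Dom C f)" and fg: "f \<cdot> g = Id C (Cod C f)"
    unfolding is_isomorphism_def Hom_def by blast
  have "u = v" if "u \<in> Hom C (Cod C f) X" "v \<in> Hom C (Cod C f) X" "u \<cdot> f = v \<cdot> f" for X u v
  proof -
    have "u = u \<cdot> (f \<cdot> g)"
      using fg Id_right[OF that(1)] by simp
    also have "\<dots> = v \<cdot> (f \<cdot> g)"
      unfolding Comp_assoc[OF g f that(1), symmetric] Comp_assoc[OF g f that(2), symmetric] that(3) ..
    also have "\<dots> = v"
      using fg Id_right[OF that(2)] by simp
    finally show ?thesis .
  qed
  with f show ?thesis
    unfolding is_epimorphism_def Hom_def by blast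
qed

end

section \<open>Universal properties, zero morphisms and cancellation tests in an additive
  category\<close>

context additive_category
begin

text \<open>Keeps only the existence half of the universal property, with the source and target of
  \<open>f\<close> named \<open>A\<close> and \<open>B\<close> so that it chains with membership in
  \<open>Hom\<close>.\<close>

lemma is_kernelE:
  assumes "is_kernel C f k" and f: "f \<in> Hom C A B"
    and h: "h \<in> Hom C X A" and "f \<cdot> h = Zero C X B"
  obtains u where "u \<in> Hom C X (Dom C k)" "k \<cdot> u = h"
proof -
  have "Dom C f = A" "Cod C f = B"
    using f by (simp_all add: Hom_def)
  then show ?thesis
    using assms Hom_Ob(1)[OF h] that unfolding is_kernel_def by blast
qed

lemma is_cokernelE:
  assumes "is_cokernel C f c" and f: "f \<in> Hom C A B"
    and h: "h \<in> Hom C B X" and "h \<cdot> f = Zero C A X"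
  obtains u where "u \<in> Hom C (Cod C c) X" "u \<cdot> c = h"
proof -
  have "Dom C f = A" "Cod C f = B"
    using f by (simp_all add: Hom_def)
  then show ?thesis
    using assms Hom_Ob(2)[OF h] that unfolding is_cokernel_def by blast
qed

lemma Zero_Hom:
  assumes "A \<in> Ob C" "B \<in> Ob C"
  shows "Zero C A B \<in> Hom C A B"
proof -
  interpret comm_group "Hom_group C A B"
    using Hom_comm_group assms .
  show ?thesis
    using one_closed by (simp add: Hom_group_def)
qed

text \<open>The only idempotent of a group is its identity. This is how composites with a zero
  morphism are recognised as zero: bilinearity makes them idempotent.\<close>

lemma Add_idem_imp_Zero:
  assumes "f \<in> Hom C A B" "f \<boxplus> f = f"
  shows "f = Zero C A B"
proof -
  interpret comm_group "Hom_group C A B"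
    using Hom_comm_group Hom_Ob[OF assms(1)] .
  show ?thesis
    using assms l_cancel_one[of f f] by (simp add: Hom_group_def)
qed

lemma Zero_Add_Zero:
  assumes "A \<in> Ob C" "B \<in> Ob C"
  shows "Zero C A B \<boxplus> Zero C A B = Zero C A B"
proof -
  interpret comm_group "Hom_group C A B"
    using Hom_comm_group assms .
  show ?thesis
    using l_one[OF one_closed] by (simp add: Hom_group_def)
qed

lemma Comp_Zero_left:
  assumes f: "f \<in> Hom C A B" and D: "D \<in> Ob C"
  shows "Zero C B D \<cdot> f = Zero C A D"
proof (rule Add_idem_imp_Zero)
  note Z = Zero_Hom[OF Hom_Ob(2)[OF f] D]
  show "Zero C B D \<cdot> f \<in> Hom C A D"
    using Comp_closed[OF f Z] .
  show "(Zero C B D \<cdot> f) \<boxplus> (Zero C B D \<cdot> f) = Zero C B D \<cdot> f"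
    using Comp_Add_left[OF f Z Z] Zero_Add_Zero[OF Hom_Ob(2)[OF f] D] by simp
qed

lemma Comp_Zero_right:
  assumes f: "f \<in> Hom C B D" and A: "A \<in> Ob C"
  shows "f \<cdot> Zero C A B = Zero C A D"
proof (rule Add_idem_imp_Zero)
  note Z = Zero_Hom[OF A Hom_Ob(1)[OF f]]
  show "f \<cdot> Zero C A B \<in> Hom C A D"
    using Comp_closed[OF Z f] .
  show "(f \<cdot> Zero C A B) \<boxplus> (f \<cdot> Zero C A B) = f \<cdot> Zero C A B"
    using Comp_Add_right[OF Z Z f] Zero_Add_Zero[OF A Hom_Ob(1)[OF f]] by simp
qed

text \<open>Stands in for subtraction, which the record does not name: \<open>w\<close> is
  \<open>u\<close> times the inverse of \<open>v\<close> in \<open>Hom_group C A B\<close>.\<close>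

lemma ex_difference:
  assumes u: "u \<in> Hom C A B" and v: "v \<in> Hom C A B"
  obtains w where "w \<in> Hom C A B" "u = w \<boxplus> v"
proof -
  interpret comm_group "Hom_group C A B"
    using Hom_comm_group Hom_Ob[OF u] .
  let ?w = "u \<otimes>\<^bsub>Hom_group C A B\<^esub> inv\<^bsub>Hom_group C A B\<^esub> v"
  have uv: "u \<in> carrier (Hom_group C A B)" "v \<in> carrier (Hom_group C A B)"
    using u v by (auto simp: Hom_group_def)
  then have "?w \<in> carrier (Hom_group C A B)" "?w \<otimes>\<^bsub>Hom_group C A B\<^esub> v = u"
    by (auto simp: m_assoc)
  then show ?thesis
    by (intro that[of ?w]) (auto simp: Hom_group_def)
qed

lemma Add_eq_right_iff:
  assumes w: "w \<in> Hom C A B" and v: "v \<in> Hom C A B"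
  shows "w \<boxplus> v = v \<longleftrightarrow> w = Zero C A B"
proof -
  interpret comm_group "Hom_group C A B"
    using Hom_comm_group Hom_Ob[OF w] .
  show ?thesis
    using assms r_cancel_one[of v w] by (simp add: Hom_group_def)
qed

text \<open>As for injectivity of a group homomorphism: \<open>f\<close> identifies \<open>u\<close>
  and \<open>v\<close> exactly when it kills their difference, so testing against zero
  suffices.\<close>

lemma is_monomorphism_iff:
  assumes f: "f \<in> Hom C A B"
  shows "is_monomorphism C f \<longleftrightarrow>
    (\<forall>X \<in> Ob C. \<forall>x \<in> Hom C X A. f \<cdot> x = Zero C X B \<longrightarrow> x = Zero C X A)"
    (is "_ \<longleftrightarrow> ?R")
proof
  assume "is_monomorphism C f"
  moreover have "Dom C f = A"
    using f by (simp add: Hom_def)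
  ultimately have inj: "u = v"
    if "X \<in> Ob C" "u \<in> Hom C X A" "v \<in> Hom C X A" "f \<cdot> u = f \<cdot> v" for X u v
    using that unfolding is_monomorphism_def by blast
  show ?R
    using Zero_Hom[OF _ Hom_Ob(1)[OF f]] Comp_Zero_right[OF f] by (auto intro: inj)
next
  assume R: ?R
  have "u = v" if X: "X \<in> Ob C" and u: "u \<in> Hom C X A" and v: "v \<in> Hom C X A"
    and eq: "f \<cdot> u = f \<cdot> v" for X u v
  proof -
    obtain w where w: "w \<in> Hom C X A" "u = w \<boxplus> v"
      using ex_difference[OF u v] .
    \<comment> \<open>Distributing \<open>f\<close> over \<open>u = w \<boxplus> v\<close> turns the
      equality of \<open>f \<cdot> u\<close> and \<open>f \<cdot> v\<close> into
      \<open>f \<cdot> w \<boxplus> f \<cdot> v = f \<cdot> v\<close>, where the second summand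
      cancels.\<close>
    have "f \<cdot> w = Zero C X B"
      using Comp_Add_right[OF w(1) v f] eq w(2)
        Add_eq_right_iff[OF Comp_closed[OF w(1) f] Comp_closed[OF v f]] by simp
    then have "w = Zero C X A"
      using R X w(1) by blast
    then show ?thesis
      using Add_eq_right_iff[OF w(1) v] w(2) by simp
  qed
  then show "is_monomorphism C f"
    using f unfolding is_monomorphism_def by (auto simp: Hom_def)
qed

lemma is_epimorphism_iff:
  assumes f: "f \<in> Hom C A B"
  shows "is_epimorphism C f \<longleftrightarrow>
    (\<forall>X \<in> Ob C. \<forall>x \<in> Hom C B X. x \<cdot> f = Zero C A X \<longrightarrow> x = Zero C B X)"
    (is "_ \<longleftrightarrow> ?R")
proof
  assume "is_epimorphism C f"
  moreover have "Cod C f = B"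
    using f by (simp add: Hom_def)
  ultimately have inj: "u = v"
    if "X \<in> Ob C" "u \<in> Hom C B X" "v \<in> Hom C B X" "u \<cdot> f = v \<cdot> f" for X u v
    using that unfolding is_epimorphism_def by blast
  show ?R
    using Zero_Hom[OF Hom_Ob(2)[OF f]] Comp_Zero_left[OF f] by (auto intro: inj)
next
  assume R: ?R
  have "u = v" if X: "X \<in> Ob C" and u: "u \<in> Hom C B X" and v: "v \<in> Hom C B X"
    and eq: "u \<cdot> f = v \<cdot> f" for X u v
  proof -
    obtain w where w: "w \<in> Hom C B X" "u = w \<boxplus> v"
      using ex_difference[OF u v] .
    have "w \<cdot> f = Zero C A X"
      using Comp_Add_left[OF f w(1) v] eq w(2)
        Add_eq_right_iff[OF Comp_closed[OF f w(1)] Comp_closed[OF f v]] by simp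
    then have "w = Zero C B X"
      using R X w(1) by blast
    then show ?thesis
      using Add_eq_right_iff[OF w(1) v] w(2) by simp
  qed
  then show "is_epimorphism C f"
    using f unfolding is_epimorphism_def by (auto simp: Hom_def)
qed

end

section \<open>Balancedness, and factorisations supplied by exactness\<close>

context abelian_category
begin

lemma is_kernel_ker: "f \<in> Arr C \<Longrightarrow> is_kernel C f (ker C f)"
  unfolding ker_def by (rule someI_ex) (rule kernel_exists)

lemma is_cokernel_cok: "f \<in> Arr C \<Longrightarrow> is_cokernel C f (cok C f)"
  unfolding cok_def by (rule someI_ex) (rule cokernel_exists)

text \<open>As a monomorphism, \<open>f\<close> is a kernel of some \<open>h\<close>. Since
  \<open>f\<close> is epi and \<open>h \<cdot> f\<close> vanishes, \<open>h\<close> is zero, so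
  every morphism into \<open>B\<close> factors through \<open>f\<close>. Factoring the identity of
  \<open>B\<close> gives a right inverse.\<close>

lemma mono_epi_imp_isomorphism:
  assumes mono: "is_monomorphism C f" and epi: "is_epimorphism C f"
  shows "is_isomorphism C f"
proof -
  obtain A B where f: "f \<in> Hom C A B"
    using mono by (auto simp: is_monomorphism_def Hom_def)
  then have dom: "Dom C f = A"
    by (simp add: Hom_def)
  note Ob = Hom_Ob[OF f]
  obtain h where h: "is_kernel C h f"
    using mono_is_kernel[OF mono] ..
  define E where "E = Cod C h"
  have hB: "h \<in> Hom C B E" and hf: "h \<cdot> f = Zero C A E"
    using h f by (auto simp: is_kernel_def Hom_def E_def)
  have "h = Zero C B E"
    using epi hf hB Hom_Ob(2)[OF hB] by (simp add: is_epimorphism_iff[OF f])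
  then have "h \<cdot> Id C B = Zero C B E"
    using Id_right[OF hB] by simp
  then obtain u where u: "u \<in> Hom C B A" and fu: "f \<cdot> u = Id C B"
    using is_kernelE[OF h hB Id_closed[OF Ob(2)]] unfolding dom by blast
  \<comment> \<open>Cancelling the monomorphism \<open>f\<close> on the left makes the right inverse
    \<open>u\<close> two-sided.\<close>
  have "f \<cdot> (u \<cdot> f) = f \<cdot> Id C A"
    using Comp_assoc[OF f u f] fu Id_left[OF f] Id_right[OF f] by simp
  then have "u \<cdot> f = Id C A"
    using mono Comp_closed[OF f u] Id_closed[OF Ob(1)] Ob(1)
    unfolding is_monomorphism_def dom by blast
  then show ?thesis
    using f u fu unfolding is_isomorphism_def by (auto simp: Hom_def)
qed

text \<open>\<open>x\<close> factors through \<open>ker C g\<close>, which exactness makes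
  \<open>cok C f\<close> annihilate. The third object is called \<open>D\<close> because
  \<open>C\<close> is the category here.\<close>

lemma short_exact_cok_Comp_eq_Zero:
  assumes ex: "short_exact C A f B g D"
    and x: "x \<in> Hom C X B" and gx: "g \<cdot> x = Zero C X D"
  shows "cok C f \<cdot> x = Zero C X (Cod C (cok C f))"
proof -
  define k c where "k = ker C g" and "c = cok C f"
  have f: "f \<in> Hom C A B" and g: "g \<in> Hom C B D"
    and ck: "c \<cdot> k = Zero C (Dom C k) (Cod C c)"
    using ex by (auto simp: short_exact_def k_def c_def)
  have ker: "is_kernel C g k" and cok: "is_cokernel C f c"
    using is_kernel_ker is_cokernel_cok f g by (auto simp: k_def c_def Hom_def)
  have k: "k \<in> Hom C (Dom C k) B" and c: "c \<in> Hom C B (Cod C c)"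
    using ker cok f g by (auto simp: is_kernel_def is_cokernel_def Hom_def)
  obtain u where u: "u \<in> Hom C X (Dom C k)" "k \<cdot> u = x"
    using is_kernelE[OF ker g x gx] .
  have "c \<cdot> x = (c \<cdot> k) \<cdot> u"
    using Comp_assoc[OF u(1) k c] u(2) by simp
  also have "\<dots> = Zero C X (Cod C c)"
    using ck Comp_Zero_left[OF u(1) Hom_Ob(2)[OF c]] by simp
  finally show ?thesis
    by (simp add: c_def)
qed

text \<open>Dual argument: \<open>y\<close> factors through \<open>cok C f\<close>, which
  annihilates \<open>ker C g\<close>.\<close>

lemma short_exact_Comp_ker_eq_Zero:
  assumes ex: "short_exact C A f B g D"
    and y: "y \<in> Hom C B Y" and yf: "y \<cdot> f = Zero C A Y"
  shows "y \<cdot> ker C g = Zero C (Dom C (ker C g)) Y"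
proof -
  define k c where "k = ker C g" and "c = cok C f"
  have f: "f \<in> Hom C A B" and g: "g \<in> Hom C B D"
    and ck: "c \<cdot> k = Zero C (Dom C k) (Cod C c)"
    using ex by (auto simp: short_exact_def k_def c_def)
  have ker: "is_kernel C g k" and cok: "is_cokernel C f c"
    using is_kernel_ker is_cokernel_cok f g by (auto simp: k_def c_def Hom_def)
  have k: "k \<in> Hom C (Dom C k) B" and c: "c \<in> Hom C B (Cod C c)"
    using ker cok f g by (auto simp: is_kernel_def is_cokernel_def Hom_def)
  obtain u where u: "u \<in> Hom C (Cod C c) Y" "u \<cdot> c = y"
    using is_cokernelE[OF cok f y yf] .
  have "y \<cdot> k = u \<cdot> (c \<cdot> k)"
    using Comp_assoc[OF k c u(1)] u(2) by simp
  also have "\<dots> = Zero C (Dom C k) Y"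
    using ck Comp_Zero_right[OF u(1) Hom_Ob(1)[OF k]] by simp
  finally show ?thesis
    by (simp add: k_def)
qed

text \<open>The monomorphism \<open>f\<close> is a kernel of some \<open>h\<close>, and \<open>h\<close> factors through \<open>cok C f\<close>.\<close>

lemma short_exact_factor_left:
  assumes ex: "short_exact C A f B g D"
    and x: "x \<in> Hom C X B" and gx: "g \<cdot> x = Zero C X D"
  obtains y where "y \<in> Hom C X A" "f \<cdot> y = x"
proof -
  define c where "c = cok C f"
  have f: "f \<in> Hom C A B" and mono: "is_monomorphism C f"
    using ex by (auto simp: short_exact_def)
  have cok: "is_cokernel C f c"
    using is_cokernel_cok f by (auto simp: c_def Hom_def)
  then have c: "c \<in> Hom C B (Cod C c)"
    using f by (auto simp: is_cokernel_def Hom_def)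
  obtain h where h: "is_kernel C h f"
    using mono_is_kernel[OF mono] ..
  define E where "E = Cod C h"
  have hB: "h \<in> Hom C B E" and hf: "h \<cdot> f = Zero C A E"
    using h f by (auto simp: is_kernel_def Hom_def E_def)
  obtain v where v: "v \<in> Hom C (Cod C c) E" "v \<cdot> c = h"
    using is_cokernelE[OF cok f hB hf] .
  have "h \<cdot> x = v \<cdot> (c \<cdot> x)"
    using Comp_assoc[OF x c v(1)] v(2) by simp
  also have "\<dots> = Zero C X E"
    using short_exact_cok_Comp_eq_Zero[OF ex x gx] Comp_Zero_right[OF v(1) Hom_Ob(1)[OF x]]
    by (simp add: c_def)
  finally have "h \<cdot> x = Zero C X E" .
  \<comment> \<open>The factor delivered by the kernel property has target \<open>Dom C f\<close>,
    which must be identified with \<open>A\<close>.\<close>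
  moreover have "Dom C f = A"
    using f by (simp add: Hom_def)
  ultimately show ?thesis
    using is_kernelE[OF h hB x] that by metis
qed

text \<open>The epimorphism \<open>g\<close> is a cokernel of some \<open>h\<close>, and
  \<open>h\<close> factors through \<open>ker C g\<close>, which \<open>y\<close> annihilates; hence
  \<open>y\<close> factors through \<open>g\<close>.\<close>

lemma short_exact_factor_right:
  assumes ex: "short_exact C A f B g D"
    and y: "y \<in> Hom C B Y" and yf: "y \<cdot> f = Zero C A Y"
  obtains z where "z \<in> Hom C D Y" "z \<cdot> g = y"
proof -
  define k where "k = ker C g"
  have g: "g \<in> Hom C B D" and epi: "is_epimorphism C g"
    using ex by (auto simp: short_exact_def)
  have ker: "is_kernel C g k"
    using is_kernel_ker g by (auto simp: k_def Hom_def)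
  then have k: "k \<in> Hom C (Dom C k) B"
    using g by (auto simp: is_kernel_def Hom_def)
  obtain h where h: "is_cokernel C h g"
    using epi_is_cokernel[OF epi] ..
  define E where "E = Dom C h"
  have hB: "h \<in> Hom C E B" and gh: "g \<cdot> h = Zero C E D"
    using h g by (auto simp: is_cokernel_def Hom_def E_def)
  obtain v where v: "v \<in> Hom C E (Dom C k)" "k \<cdot> v = h"
    using is_kernelE[OF ker g hB gh] .
  have "y \<cdot> h = (y \<cdot> k) \<cdot> v"
    using Comp_assoc[OF v(1) k y] v(2) by simp
  also have "\<dots> = Zero C E Y"
    using short_exact_Comp_ker_eq_Zero[OF ex y yf] Comp_Zero_left[OF v(1) Hom_Ob(2)[OF y]]
    by (simp add: k_def)
  finally have "y \<cdot> h = Zero C E Y" .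
  moreover have "Cod C g = D"
    using g by (simp add: Hom_def)
  ultimately show ?thesis
    using is_cokernelE[OF h hB y] that by metis
qed

section \<open>The diagram chases of the short five lemma\<close>

lemma short_five_mono:
  assumes ex: "short_exact C A f B g D" and ex': "short_exact C A' f' B' g' D'"
    and a: "a \<in> Hom C A A'" and b: "b \<in> Hom C B B'" and d: "d \<in> Hom C D D'"
    and left: "f' \<cdot> a = b \<cdot> f" and right: "g' \<cdot> b = d \<cdot> g"
    and mono: "is_monomorphism C a" "is_monomorphism C d"
  shows "is_monomorphism C b"
  unfolding is_monomorphism_iff[OF b]
proof (intro ballI impI)
  have f: "f \<in> Hom C A B" and g: "g \<in> Hom C B D"
    and f': "f' \<in> Hom C A' B'" and g': "g' \<in> Hom C B' D'"
    and f'_mono: "is_monomorphism C f'"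
    using ex ex' by (auto simp: short_exact_def)
  fix X x
  assume X: "X \<in> Ob C" and x: "x \<in> Hom C X B" and bx: "b \<cdot> x = Zero C X B'"
  note gx = Comp_closed[OF x g]
  \<comment> \<open>The right square transports the vanishing of \<open>b \<cdot> x\<close> to
    \<open>d \<cdot> (g \<cdot> x)\<close>, where the monomorphism \<open>d\<close> can be
    cancelled.\<close>
  have "d \<cdot> (g \<cdot> x) = g' \<cdot> (b \<cdot> x)"
    using Comp_assoc[OF x g d] Comp_assoc[OF x b g'] right by simp
  also have "\<dots> = Zero C X D'"
    using bx Comp_Zero_right[OF g' X] by simp
  finally have "g \<cdot> x = Zero C X D"
    using mono(2) gx X by (simp add: is_monomorphism_iff[OF d])
  then obtain y where y: "y \<in> Hom C X A" "f \<cdot> y = x"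
    by (rule short_exact_factor_left[OF ex x])
  note ay = Comp_closed[OF y(1) a]
  have "f' \<cdot> (a \<cdot> y) = b \<cdot> (f \<cdot> y)"
    using Comp_assoc[OF y(1) a f'] Comp_assoc[OF y(1) f b] left by simp
  then have "f' \<cdot> (a \<cdot> y) = Zero C X B'"
    using bx y(2) by simp
  then have "a \<cdot> y = Zero C X A'"
    using f'_mono ay X by (simp add: is_monomorphism_iff[OF f'])
  then have "y = Zero C X A"
    using mono(1) y(1) X by (simp add: is_monomorphism_iff[OF a])
  then show "x = Zero C X B"
    using y(2) Comp_Zero_right[OF f X] by simp
qed

text \<open>The dual chase begins at the left square: cancelling \<open>a\<close> shows that
  \<open>y\<close> kills \<open>f'\<close>, so \<open>y\<close> factors through \<open>g'\<close>.
  The factorisation happens in the target row, whereas the monomorphism case factors in the source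
  row.\<close>

lemma short_five_epi:
  assumes ex: "short_exact C A f B g D" and ex': "short_exact C A' f' B' g' D'"
    and a: "a \<in> Hom C A A'" and b: "b \<in> Hom C B B'" and d: "d \<in> Hom C D D'"
    and left: "f' \<cdot> a = b \<cdot> f" and right: "g' \<cdot> b = d \<cdot> g"
    and epi: "is_epimorphism C a" "is_epimorphism C d"
  shows "is_epimorphism C b"
  unfolding is_epimorphism_iff[OF b]
proof (intro ballI impI)
  have f: "f \<in> Hom C A B" and g: "g \<in> Hom C B D"
    and f': "f' \<in> Hom C A' B'" and g': "g' \<in> Hom C B' D'"
    and g_epi: "is_epimorphism C g"
    using ex ex' by (auto simp: short_exact_def)
  fix Y y
  assume Y: "Y \<in> Ob C" and y: "y \<in> Hom C B' Y" and yb: "y \<cdot> b = Zero C B Y"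
  note yf' = Comp_closed[OF f' y]
  have "(y \<cdot> f') \<cdot> a = (y \<cdot> b) \<cdot> f"
    using Comp_assoc[OF a f' y] Comp_assoc[OF f b y] left by simp
  also have "\<dots> = Zero C A Y"
    using yb Comp_Zero_left[OF f Y] by simp
  finally have "y \<cdot> f' = Zero C A' Y"
    using epi(1) yf' Y by (simp add: is_epimorphism_iff[OF a])
  then obtain z where z: "z \<in> Hom C D' Y" "z \<cdot> g' = y"
    by (rule short_exact_factor_right[OF ex' y])
  note zd = Comp_closed[OF d z(1)]
  \<comment> \<open>The right square rewrites \<open>y \<cdot> b\<close> as
    \<open>z \<cdot> d \<cdot> g\<close>, from which first \<open>g\<close> and then
    \<open>d\<close> is cancelled on the right.\<close>
  have "(z \<cdot> d) \<cdot> g = (z \<cdot> g') \<cdot> b"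
    using Comp_assoc[OF g d z(1)] Comp_assoc[OF b g' z(1)] right by simp
  then have "(z \<cdot> d) \<cdot> g = Zero C B Y"
    using yb z(2) by simp
  then have "z \<cdot> d = Zero C D Y"
    using g_epi zd Y by (simp add: is_epimorphism_iff[OF g])
  then have "z = Zero C D' Y"
    using epi(2) z(1) Y by (simp add: is_epimorphism_iff[OF d])
  then show "y = Zero C B' Y"
    using z(2) Comp_Zero_left[OF g' Y] by simp
qed

end

theorem theorem5p4:
  fixes \<A> :: "('o, 'm, 'x) add_cat_scheme" (structure)
    and A B C A' B' C' :: 'o
    and f g f' g' \<alpha> \<beta> \<gamma> :: 'm
  assumes "abelian_category \<A>"
    and "short_exact \<A> A f B g C"
    and "short_exact \<A> A' f' B' g' C'"
    and "\<alpha> \<in> Hom \<A> A A'"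
    and "\<beta> \<in> Hom \<A> B B'"
    and "\<gamma> \<in> Hom \<A> C C'"
    and "f' \<cdot> \<alpha> = \<beta> \<cdot> f"
    and "g' \<cdot> \<beta> = \<gamma> \<cdot> g"
  shows "(is_monomorphism \<A> \<alpha> \<and> is_monomorphism \<A> \<gamma> \<longrightarrow> is_monomorphism \<A> \<beta>) \<and>
    (is_epimorphism \<A> \<alpha> \<and> is_epimorphism \<A> \<gamma> \<longrightarrow> is_epimorphism \<A> \<beta>) \<and>
    (is_isomorphism \<A> \<alpha> \<and> is_isomorphism \<A> \<gamma> \<longrightarrow> is_isomorphism \<A> \<beta>)"
proof -
  interpret abelian_category \<A>
    by fact
  have mono: "is_monomorphism \<A> \<beta>" if "is_monomorphism \<A> \<alpha>" "is_monomorphism \<A> \<gamma>"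
    using short_five_mono[OF assms(2-8) that] .
  have epi: "is_epimorphism \<A> \<beta>" if "is_epimorphism \<A> \<alpha>" "is_epimorphism \<A> \<gamma>"
    using short_five_epi[OF assms(2-8) that] .
  show ?thesis
    using mono epi mono_epi_imp_isomorphism isomorphism_imp_monomorphism
      isomorphism_imp_epimorphism by blast
qed

end
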